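(* Let $Z$ and $W$ be $E$-valued random elements. If $\nu_Z\in M_{\chi_\alpha,\sigma}(E)$, then $$\nu_W=\nu_Z\quad\Longleftrightarrow\quad \mathbb E\{\Gamma(W)\}=\mathbb E\{\Gamma(Z)\}\ \text{ for every }\Gamma\in\mathcal H_\alpha(E),$$ where equality of expectations is understood in $[0,\infty]$.
   Context: Let $q\ge1$ be an integer, $(E,\mathcal E)$ an arbitrary measurable space, and $G=(0,\infty)^q$ with coordinatewise multiplication and its Borel $\sigma$-field. Let $S:G\times E\to E$, $(r,x)\mapsto S_rx$, be a jointly measurable left action: $S_{\boldsymbol 1}x=x$ with $\boldsymbol 1=(1,\ldots,1)$, and $S_r(S_sx)=S_{rs}x$. Fix $\alpha=(\alpha_1,\ldots,\alpha_q)\in(0,\infty)^q$ and put $\chi_\alpha(r)=\prod_{i=1}^q r_i^{\alpha_i}$ and $\vartheta_\alpha(dr)=\prod_{i=1}^q\alpha_i r_i^{-\alpha_i-1}\,dr_i$ (a measure on $G$). A measure $\nu$ on $(E,\mathcal E)$ is $\chi_\alpha$-homogeneous if $\nu(S_rA)=\chi_\alpha(r)^{-1}\nu(A)$ for all $r\in G$, $A\in\mathcal E$. $M_{\chi_\alpha,\sigma}(E)$ is the set of nonzero $\sigma$-finite $\chi_\alpha$-homogeneous measures. For an $E$-valued random element $Z$, $\nu_Z(A)=\mathbb E\left\{\int_G\mathbb I_A(S_rZ)\,\vartheta_\alpha(dr)\right\}$, $A\in\mathcal E$ (this measure is $\chi_\alpha$-homogeneous). $\mathcal H_\alpha(E)$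 is the set of all measurable $\Gamma:E\to[0,\infty]$ such that $\Gamma(S_rx)=\chi_\alpha(r)\Gamma(x)$ for all $r\in G$, $x\in E$. *)

theory Defs
  imports "HOL-Probability.Probability"
begin

text \<open>
  The index type \<open>'q\<close> is finite and, like every type, nonempty; its cardinality plays the role
  of \<open>q \<ge> 1\<close>. A measurable space is represented by a measure \<open>E\<close> of which only \<open>space E\<close> and
  \<open>sets E\<close> are used.
\<close>

definition pos_orthant :: "(real ^ 'q) set" where
  "pos_orthant = {r. \<forall>i. 0 < r $ i}"

definition orthant_space :: "(real ^ 'q) measure" where
  "orthant_space = restrict_space borel pos_orthant"

definition vec_mult :: "real ^ 'q \<Rightarrow> real ^ 'q \<Rightarrow> real ^ 'q" where
  "vec_mult r s = (\<chi> i. r $ i * s $ i)"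

definition measurable_action :: "'a measure \<Rightarrow> (real ^ 'q \<Rightarrow> 'a \<Rightarrow> 'a) \<Rightarrow> bool" where
  "measurable_action E S \<longleftrightarrow>
     (\<lambda>(r, x). S r x) \<in> orthant_space \<Otimes>\<^sub>M E \<rightarrow>\<^sub>M E \<and>
     (\<forall>x\<in>space E. S (\<chi> i. 1) x = x) \<and>
     (\<forall>r\<in>pos_orthant. \<forall>s\<in>pos_orthant. \<forall>x\<in>space E. S r (S s x) = S (vec_mult r s) x)"

definition multipower :: "real ^ 'q \<Rightarrow> real ^ 'q \<Rightarrow> real" where
  "multipower \<alpha> r = (\<Prod>i\<in>UNIV. r $ i powr \<alpha> $ i)"

definition theta :: "real ^ 'q \<Rightarrow> (real ^ 'q) measure" where
  "theta \<alpha> = density (restrict_space lborel pos_orthant)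
     (\<lambda>r. ennreal (\<Prod>i\<in>UNIV. \<alpha> $ i * r $ i powr (- (\<alpha> $ i) - 1)))"

definition homogeneous_measure ::
    "'a measure \<Rightarrow> (real ^ 'q \<Rightarrow> 'a \<Rightarrow> 'a) \<Rightarrow> real ^ 'q \<Rightarrow> 'a measure \<Rightarrow> bool" where
  "homogeneous_measure E S \<alpha> \<nu> \<longleftrightarrow> sets \<nu> = sets E \<and>
     (\<forall>r\<in>pos_orthant. \<forall>A\<in>sets E.
        emeasure \<nu> (S r ` A) = ennreal (inverse (multipower \<alpha> r)) * emeasure \<nu> A)"

definition sigma_finite_homogeneous_measures ::
    "'a measure \<Rightarrow> (real ^ 'q \<Rightarrow> 'a \<Rightarrow> 'a) \<Rightarrow> real ^ 'q \<Rightarrow> 'a measure set" where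
  "sigma_finite_homogeneous_measures E S \<alpha> =
     {\<nu>. homogeneous_measure E S \<alpha> \<nu> \<and> sigma_finite_measure \<nu> \<and> emeasure \<nu> (space E) \<noteq> 0}"

text \<open>
  \<open>measure_of\<close> yields the zero measure when the given set function is not a measure; the lemma
  \<open>emeasure_orbit_measure\<close> below shows that this does not happen here.
\<close>

definition orbit_measure ::
    "'a measure \<Rightarrow> (real ^ 'q \<Rightarrow> 'a \<Rightarrow> 'a) \<Rightarrow> real ^ 'q \<Rightarrow> 'b measure \<Rightarrow> ('b \<Rightarrow> 'a) \<Rightarrow> 'a measure" where
  "orbit_measure E S \<alpha> M Z = measure_of (space E) (sets E)
     (\<lambda>A. \<integral>\<^sup>+ \<omega>. (\<integral>\<^sup>+ r. indicator A (S r (Z \<omega>)) \<partial>theta \<alpha>) \<partial>M)"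

definition homogeneous_functions ::
    "'a measure \<Rightarrow> (real ^ 'q \<Rightarrow> 'a \<Rightarrow> 'a) \<Rightarrow> real ^ 'q \<Rightarrow> ('a \<Rightarrow> ennreal) set" where
  "homogeneous_functions E S \<alpha> = {\<Gamma> \<in> borel_measurable E.
     \<forall>r\<in>pos_orthant. \<forall>x\<in>space E. \<Gamma> (S r x) = ennreal (multipower \<alpha> r) * \<Gamma> x}"

lemma sets_pos_orthant: "pos_orthant \<in> sets (borel :: (real ^ 'q) measure)"
proof -
  have "pos_orthant = (\<Inter>i. {r :: real ^ 'q. 0 < r $ i})"
    by (auto simp: pos_orthant_def)
  moreover have "open (\<Inter>i. {r :: real ^ 'q. 0 < r $ i})"
    by (intro open_INT ballI open_Collect_less continuous_intros) auto
  ultimately show ?thesis by (simp add: borel_open)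
qed

lemma sets_theta: "sets (theta \<alpha>) = sets orthant_space"
  unfolding theta_def orthant_space_def
  by (simp add: sets_restrict_space)

lemma sigma_finite_theta: fixes \<alpha> :: "real ^ 'q" shows "sigma_finite_measure (theta \<alpha>)"
proof -
  interpret L: sigma_finite_measure "restrict_space lborel (pos_orthant :: (real ^ 'q) set)"
    by (rule sigma_finite_measure_restrict_space[OF lborel.sigma_finite_measure_axioms])
       (simp add: sets_pos_orthant)
  have [measurable]: "(\<lambda>r. r $ i) \<in> borel_measurable (borel :: (real ^ 'q) measure)" for i
    by (intro borel_measurable_continuous_onI continuous_intros)
  have "(\<lambda>r :: real ^ 'q. ennreal (\<Prod>i\<in>UNIV. \<alpha> $ i * r $ i powr (- (\<alpha> $ i) - 1)))
      \<in> borel_measurable (restrict_space lborel pos_orthant)"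
    by (rule measurable_restrict_space1) measurable
  then show ?thesis
    unfolding theta_def by (subst L.sigma_finite_iff_density_finite) auto
qed

lemma emeasure_orbit_measure:
  assumes S: "measurable_action E S" and Z: "Z \<in> M \<rightarrow>\<^sub>M E" and A: "A \<in> sets E"
  shows "emeasure (orbit_measure E S \<alpha> M Z) A
    = (\<integral>\<^sup>+ \<omega>. (\<integral>\<^sup>+ r. indicator A (S r (Z \<omega>)) \<partial>theta \<alpha>) \<partial>M)"
proof -
  interpret T: sigma_finite_measure "theta \<alpha>" by (rule sigma_finite_theta)
  have act: "(\<lambda>(r, x). S r x) \<in> theta \<alpha> \<Otimes>\<^sub>M E \<rightarrow>\<^sub>M E"
    using S sets_theta[of \<alpha>] unfolding measurable_action_def
    by (metis measurable_cong_sets sets_pair_measure_cong)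
  have [measurable]: "(\<lambda>(\<omega>, r). S r (Z \<omega>)) \<in> M \<Otimes>\<^sub>M theta \<alpha> \<rightarrow>\<^sub>M E"
  proof -
    have "(\<lambda>p. (snd p, Z (fst p))) \<in> M \<Otimes>\<^sub>M theta \<alpha> \<rightarrow>\<^sub>M theta \<alpha> \<Otimes>\<^sub>M E"
      using Z by measurable
    from measurable_compose[OF this act] show ?thesis by (simp add: case_prod_beta)
  qed
  have inner: "(\<integral>\<^sup>+ r. indicator B (S r (Z \<omega>)) \<partial>theta \<alpha>)
      = emeasure (distr (theta \<alpha>) E (\<lambda>r. S r (Z \<omega>))) B"
    if "B \<in> sets E" "\<omega> \<in> space M" for B \<omega>
    using that by (subst nn_integral_distr[symmetric, of _ _ E]) auto
  have meas: "(\<lambda>\<omega>. \<integral>\<^sup>+ r. indicator B (S r (Z \<omega>)) \<partial>theta \<alpha>) \<in> borel_measurable M"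
    if [measurable]: "B \<in> sets E" for B
    by (rule T.borel_measurable_nn_integral) measurable
  show ?thesis
  proof (rule emeasure_measure_of[OF orbit_measure_def])
    show "sets E \<subseteq> Pow (space E)" by (rule sets.space_closed)
    show "A \<in> sets (orbit_measure E S \<alpha> M Z)"
      using A by (simp add: orbit_measure_def sets.sigma_sets_eq sets.space_closed)
    show "positive (sets (orbit_measure E S \<alpha> M Z))
        (\<lambda>A. \<integral>\<^sup>+ \<omega>. (\<integral>\<^sup>+ r. indicator A (S r (Z \<omega>)) \<partial>theta \<alpha>) \<partial>M)"
      by (simp add: positive_def)
    show "countably_additive (sets (orbit_measure E S \<alpha> M Z))
        (\<lambda>A. \<integral>\<^sup>+ \<omega>. (\<integral>\<^sup>+ r. indicator A (S r (Z \<omega>)) \<partial>theta \<alpha>) \<partial>M)"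
    proof (rule countably_additiveI)
      fix F :: "nat \<Rightarrow> 'a set"
      assume "range F \<subseteq> sets (orbit_measure E S \<alpha> M Z)" and dj: "disjoint_family F"
      then have F: "range F \<subseteq> sets E" and Fi [simp]: "F i \<in> sets E" for i
        by (auto simp: orbit_measure_def sets.sigma_sets_eq sets.space_closed)
      have U: "(\<Union>i. F i) \<in> sets E" using F by blast
      have "(\<Sum>i. \<integral>\<^sup>+ \<omega>. (\<integral>\<^sup>+ r. indicator (F i) (S r (Z \<omega>)) \<partial>theta \<alpha>) \<partial>M)
          = (\<integral>\<^sup>+ \<omega>. (\<Sum>i. \<integral>\<^sup>+ r. indicator (F i) (S r (Z \<omega>)) \<partial>theta \<alpha>) \<partial>M)"
        by (rule nn_integral_suminf[symmetric]) (rule meas, simp)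
      also have "\<dots> = (\<integral>\<^sup>+ \<omega>. (\<integral>\<^sup>+ r. indicator (\<Union>i. F i) (S r (Z \<omega>)) \<partial>theta \<alpha>) \<partial>M)"
        using F U dj by (intro nn_integral_cong) (simp add: inner suminf_emeasure)
      finally show "(\<Sum>i. \<integral>\<^sup>+ \<omega>. (\<integral>\<^sup>+ r. indicator (F i) (S r (Z \<omega>)) \<partial>theta \<alpha>) \<partial>M)
          = (\<integral>\<^sup>+ \<omega>. (\<integral>\<^sup>+ r. indicator (\<Union>i. F i) (S r (Z \<omega>)) \<partial>theta \<alpha>) \<partial>M)" .
    qed
  qed
qed

end

theory Submission
  imports Defs
begin

text \<open>
  Write \<open>\<Gamma>\<^sub>f x = \<integral> f (S r x) \<theta>(dr)\<close> for measurable \<open>f \<ge> 0\<close>. Two facts drive the proof. Since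
  \<open>\<theta>\<close> is relatively invariant under multiplication, with multiplier \<open>\<chi>\<close>, the function
  \<open>\<Gamma>\<^sub>f\<close> is homogeneous (\<open>orbit_integral_homogeneous\<close>); and by Tonelli
  \<open>\<integral> f d\<nu>\<^sub>Z = \<bbbE> \<Gamma>\<^sub>f(Z)\<close> (\<open>nn_integral_orbit_measure\<close>).

  If all homogeneous moments of \<open>W\<close> and \<open>Z\<close> agree, then in particular those of \<open>\<Gamma>\<^sub>f\<close> with \<open>f\<close>
  the indicator of \<open>A\<close> do, which is \<open>\<nu>\<^sub>W(A) = \<nu>\<^sub>Z(A)\<close>.

  For the converse the moments have to be recovered from \<open>\<nu>\<^sub>Z\<close>. One might try
  \<open>\<nu>\<^sub>Z{\<Gamma> > 1}\<close>, which equals \<open>\<bbbE> \<Gamma>(Z)\<close> if \<open>q = 1\<close>, but it is infinite in higher dimension as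
  soon as \<open>\<Gamma>(Z)\<close> does not vanish almost surely. Instead, \<open>\<sigma>\<close>-finiteness provides a strictly
  positive \<open>f\<close> with \<open>\<integral> f d\<nu>\<^sub>Z < \<infinity>\<close>. Then \<open>0 < \<Gamma>\<^sub>f(Z) < \<infinity>\<close> almost surely, the ratio
  \<open>\<Gamma>/\<Gamma>\<^sub>f\<close> is constant along orbits, and integrating \<open>f \<cdot> \<Gamma>/\<Gamma>\<^sub>f\<close> over the orbit of \<open>Z\<close>
  returns \<open>\<Gamma>(Z)\<close>. Hence \<open>\<bbbE> \<Gamma>(Z) = \<integral> f \<cdot> \<Gamma>/\<Gamma>\<^sub>f d\<nu>\<^sub>Z\<close>
  (\<open>homogeneous_moment_via_orbit_measure\<close>), and the right-hand side depends on \<open>Z\<close> only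
  through \<open>\<nu>\<^sub>Z\<close>.
\<close>

section \<open>Multiplication on the orthant and the measure theta\<close>

lemma vec_mult_in_pos_orthant_iff:
  assumes "s \<in> pos_orthant"
  shows "vec_mult s r \<in> pos_orthant \<longleftrightarrow> r \<in> pos_orthant"
  using assms by (auto simp: pos_orthant_def vec_mult_def zero_less_mult_iff dest: less_asym)

lemma vec_mult_commute: "vec_mult r s = vec_mult s r"
  by (simp add: vec_mult_def mult.commute)

lemma borel_measurable_vec_mult [measurable]: "vec_mult s \<in> borel_measurable borel"
  unfolding vec_mult_def by (intro borel_measurable_continuous_onI continuous_intros)

lemma multipower_pos:
  assumes "s \<in> pos_orthant"
  shows "0 < multipower \<alpha> s"
  unfolding multipower_def
proof (rule prod_pos)
  fix i
  have "0 < s $ i" using assms by (simp add: pos_orthant_def)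
  then show "0 < s $ i powr \<alpha> $ i" by simp
qed

text \<open>The Jacobian of the diagonal map \<open>r \<mapsto> s r\<close> is the product of the coordinates of \<open>s\<close>.\<close>

lemma lborel_vec_mult:
  fixes s :: "real ^ 'q"
  assumes s: "s \<in> pos_orthant"
  shows "lborel = density (distr lborel borel (vec_mult s)) (\<lambda>_. ennreal (\<Prod>i\<in>UNIV. s $ i))"
proof -
  have Basis_eq: "(Basis :: (real ^ 'q) set) = (\<lambda>i. axis i 1) ` UNIV"
    by (auto simp: Basis_vec_def)
  have inj: "inj (\<lambda>i. axis i 1 :: real ^ 'q)"
    by (auto simp: inj_def axis_eq_axis)
  have T: "(\<lambda>x. 0 + (\<Sum>j\<in>Basis. ((s \<bullet> j) * (x \<bullet> j)) *\<^sub>R j)) = vec_mult s"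
  proof
    fix x
    have "vec_mult s x = (\<Sum>j\<in>Basis. (vec_mult s x \<bullet> j) *\<^sub>R j)"
      by (simp add: euclidean_representation)
    also have "\<dots> = (\<Sum>j\<in>Basis. ((s \<bullet> j) * (x \<bullet> j)) *\<^sub>R j)"
      by (intro sum.cong) (auto simp: Basis_eq inner_axis vec_mult_def)
    finally show "0 + (\<Sum>j\<in>Basis. ((s \<bullet> j) * (x \<bullet> j)) *\<^sub>R j) = vec_mult s x" by simp
  qed
  have P: "(\<Prod>j\<in>Basis. \<bar>s \<bullet> j\<bar>) = (\<Prod>i\<in>UNIV. s $ i)"
    using s unfolding Basis_eq prod.reindex[OF inj]
    by (intro prod.cong) (auto simp: inner_axis pos_orthant_def less_imp_le)
  have "s $ i \<noteq> 0" for i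
    using s less_irrefl[of "0 :: real"] by (metis mem_Collect_eq pos_orthant_def)
  then have "s \<bullet> j \<noteq> 0" if "j \<in> Basis" for j
    using that by (auto simp: Basis_eq inner_axis)
  from lborel_affine_euclidean[where c = "\<lambda>j. s \<bullet> j" and t = 0, OF this]
  show ?thesis unfolding T P by simp
qed

lemma nn_integral_theta:
  fixes h :: "real ^ 'q \<Rightarrow> ennreal"
  assumes h: "h \<in> borel_measurable orthant_space"
  shows "(\<integral>\<^sup>+ r. h r \<partial>theta \<alpha>) =
    (\<integral>\<^sup>+ r. ennreal (\<Prod>i\<in>UNIV. \<alpha> $ i * r $ i powr (- (\<alpha> $ i) - 1)) *
        (h r * indicator pos_orthant r) \<partial>lborel)"
proof -
  have [measurable]: "(\<lambda>r. r $ i) \<in> borel_measurable (borel :: (real ^ 'q) measure)" for i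
    by (intro borel_measurable_continuous_onI continuous_intros)
  have sets_eq: "sets (restrict_space lborel pos_orthant)
      = sets (orthant_space :: (real ^ 'q) measure)"
    by (simp add: orthant_space_def sets_restrict_space)
  have "h \<in> borel_measurable (restrict_space lborel pos_orthant)"
    using h measurable_cong_sets[OF sets_eq refl] by blast
  moreover have "(\<lambda>r :: real ^ 'q. ennreal (\<Prod>i\<in>UNIV. \<alpha> $ i * r $ i powr (- (\<alpha> $ i) - 1)))
      \<in> borel_measurable (restrict_space lborel pos_orthant)"
    by (rule measurable_restrict_space1) measurable
  ultimately show ?thesis
    unfolding theta_def
    by (subst nn_integral_density)
       (simp_all add: nn_integral_restrict_space sets_pos_orthant mult.assoc)
qed

text \<open>
  Relative invariance of \<open>\<theta>\<close>: substituting \<open>r \<mapsto> s r\<close> in the integral of \<open>h\<close>, the density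
  contributes \<open>s\<^sub>i powr (- \<alpha>\<^sub>i - 1)\<close> and the Jacobian \<open>s\<^sub>i\<close> for each coordinate; together
  these are \<open>1 / \<chi> s\<close>.
\<close>

lemma nn_integral_theta_vec_mult:
  fixes h :: "real ^ 'q \<Rightarrow> ennreal"
  assumes s: "s \<in> pos_orthant" and h: "h \<in> borel_measurable orthant_space"
  shows "(\<integral>\<^sup>+ r. h (vec_mult s r) \<partial>theta \<alpha>)
    = ennreal (multipower \<alpha> s) * (\<integral>\<^sup>+ r. h r \<partial>theta \<alpha>)"
proof -
  define d :: "real ^ 'q \<Rightarrow> real"
    where "d r = (\<Prod>i\<in>UNIV. \<alpha> $ i * r $ i powr (- (\<alpha> $ i) - 1))" for r
  define g where "g r = h r * indicator pos_orthant r" for r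
  define J where "J = (\<Prod>i\<in>UNIV. s $ i)"
  define K where "K = (\<Prod>i\<in>UNIV. s $ i powr (- (\<alpha> $ i) - 1))"
  have spos: "0 < s $ i" for i using s by (simp add: pos_orthant_def)
  have [measurable]: "(\<lambda>r. r $ i) \<in> borel_measurable (borel :: (real ^ 'q) measure)" for i
    by (intro borel_measurable_continuous_onI continuous_intros)
  have [measurable]: "d \<in> borel_measurable borel"
    unfolding d_def[abs_def] by measurable
  have [measurable]: "g \<in> borel_measurable borel"
    using h unfolding g_def[abs_def] orthant_space_def
    by (subst (asm) borel_measurable_restrict_space_iff_ennreal) (simp_all add: sets_pos_orthant)
  have K0: "0 \<le> K" unfolding K_def by (intro prod_nonneg) simp
  have J0: "0 \<le> J" unfolding J_def by (intro prod_nonneg) (simp add: spos less_imp_le)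
  have d_mult: "d (vec_mult s r) * indicator pos_orthant r = K * d r * indicator pos_orthant r" for r
  proof (cases "r \<in> pos_orthant")
    case True
    then have "0 < r $ i" for i by (simp add: pos_orthant_def)
    then show ?thesis
      by (simp add: d_def K_def vec_mult_def powr_mult spos less_imp_le prod.distrib[symmetric]
          mult_ac)
  qed simp
  have one: "multipower \<alpha> s * (J * K) = 1"
  proof -
    have "x powr a * (x * x powr (- a - 1)) = 1" if "0 < x" for x a :: real
      using that by (simp add: powr_diff powr_minus field_simps)
    then show ?thesis
      by (simp add: multipower_def J_def K_def prod.distrib[symmetric] spos)
  qed
  have "h \<circ> vec_mult s \<in> borel_measurable orthant_space"
  proof (rule measurable_comp[OF _ h])
    show "vec_mult s \<in> orthant_space \<rightarrow>\<^sub>M orthant_space"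
      unfolding orthant_space_def
      by (rule measurable_restrict_space3) (auto simp: vec_mult_in_pos_orthant_iff[OF s])
  qed
  then have hs: "(\<lambda>r. h (vec_mult s r)) \<in> borel_measurable orthant_space"
    by (simp add: comp_def)
  have "(\<integral>\<^sup>+ r. h r \<partial>theta \<alpha>) = (\<integral>\<^sup>+ r. ennreal (d r) * g r \<partial>lborel)"
    by (simp add: nn_integral_theta[OF h] d_def g_def)
  also have "\<dots> = ennreal J * (\<integral>\<^sup>+ r. ennreal (d (vec_mult s r)) * g (vec_mult s r) \<partial>lborel)"
    by (subst lborel_vec_mult[OF s])
       (simp add: nn_integral_density nn_integral_distr nn_integral_cmult J_def)
  also have "(\<integral>\<^sup>+ r. ennreal (d (vec_mult s r)) * g (vec_mult s r) \<partial>lborel)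
      = (\<integral>\<^sup>+ r. ennreal K * (ennreal (d r) * g (vec_mult s r)) \<partial>lborel)"
  proof (rule nn_integral_cong)
    fix r
    show "ennreal (d (vec_mult s r)) * g (vec_mult s r)
        = ennreal K * (ennreal (d r) * g (vec_mult s r))"
      using d_mult[of r] K0
      by (cases "r \<in> pos_orthant")
         (auto simp: g_def vec_mult_in_pos_orthant_iff[OF s] ennreal_mult' mult.assoc)
  qed
  also have "\<dots> = ennreal K * (\<integral>\<^sup>+ r. ennreal (d r) * g (vec_mult s r) \<partial>lborel)"
    by (rule nn_integral_cmult) measurable
  also have "(\<integral>\<^sup>+ r. ennreal (d r) * g (vec_mult s r) \<partial>lborel)
      = (\<integral>\<^sup>+ r. h (vec_mult s r) \<partial>theta \<alpha>)"
    unfolding nn_integral_theta[OF hs]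
    by (intro nn_integral_cong)
       (simp add: d_def g_def indicator_def vec_mult_in_pos_orthant_iff[OF s])
  finally have "ennreal (multipower \<alpha> s) * (\<integral>\<^sup>+ r. h r \<partial>theta \<alpha>)
      = ennreal (multipower \<alpha> s * (J * K)) * (\<integral>\<^sup>+ r. h (vec_mult s r) \<partial>theta \<alpha>)"
    using J0 K0 multipower_pos[OF s, of \<alpha>] by (simp add: ennreal_mult mult.assoc)
  then show ?thesis by (simp add: one)
qed

section \<open>Integration along orbits\<close>

definition orbit_integral ::
    "(real ^ 'q \<Rightarrow> 'a \<Rightarrow> 'a) \<Rightarrow> real ^ 'q \<Rightarrow> ('a \<Rightarrow> ennreal) \<Rightarrow> 'a \<Rightarrow> ennreal" where
  "orbit_integral S \<alpha> f x = (\<integral>\<^sup>+ r. f (S r x) \<partial>theta \<alpha>)"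

lemma space_theta: "space (theta \<alpha>) = pos_orthant"
  by (simp add: theta_def space_restrict_space)

lemma measurable_action_theta:
  assumes "measurable_action E S"
  shows "(\<lambda>(r, x). S r x) \<in> theta \<alpha> \<Otimes>\<^sub>M E \<rightarrow>\<^sub>M E"
  using assms sets_theta[of \<alpha>] unfolding measurable_action_def
  by (metis measurable_cong_sets sets_pair_measure_cong)

lemma measurable_orbit:
  assumes S: "measurable_action E S" and x: "x \<in> space E"
  shows "(\<lambda>r. S r x) \<in> theta \<alpha> \<rightarrow>\<^sub>M E"
  using measurable_compose[OF measurable_Pair[OF measurable_ident measurable_const[OF x]]
    measurable_action_theta[OF S]] by simp

lemma orbit_closed:
  assumes S: "measurable_action E S" and "x \<in> space E" "r \<in> pos_orthant"
  shows "S r x \<in> space E"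
  using measurable_space[OF measurable_orbit[OF S]] assms by (auto simp: space_theta)

lemma borel_measurable_orbit_integral:
  assumes S: "measurable_action E S" and f: "f \<in> borel_measurable E"
  shows "orbit_integral S \<alpha> f \<in> borel_measurable E"
proof -
  interpret T: sigma_finite_measure "theta \<alpha>" by (rule sigma_finite_theta)
  note [measurable] = f
  have "(\<lambda>p. (snd p, fst p)) \<in> E \<Otimes>\<^sub>M theta \<alpha> \<rightarrow>\<^sub>M theta \<alpha> \<Otimes>\<^sub>M E"
    by measurable
  from measurable_compose[OF this measurable_action_theta[OF S]]
  have [measurable]: "(\<lambda>(x, r). S r x) \<in> E \<Otimes>\<^sub>M theta \<alpha> \<rightarrow>\<^sub>M E"
    by (simp add: case_prod_beta)
  show ?thesis
    unfolding orbit_integral_def[abs_def]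
    by (rule T.borel_measurable_nn_integral) measurable
qed

text \<open>
  Replacing \<open>x\<close> by \<open>S s x\<close> multiplies the integration variable by \<open>s\<close>, so homogeneity of the
  orbit integral is the relative invariance of \<open>\<theta>\<close>.
\<close>

lemma orbit_integral_homogeneous:
  assumes S: "measurable_action E S" and f: "f \<in> borel_measurable E"
  shows "orbit_integral S \<alpha> f \<in> homogeneous_functions E S \<alpha>"
proof -
  have "orbit_integral S \<alpha> f (S s x) = ennreal (multipower \<alpha> s) * orbit_integral S \<alpha> f x"
    if s: "s \<in> pos_orthant" and x: "x \<in> space E" for s x
  proof -
    have "(\<lambda>r. f (S r x)) \<in> borel_measurable (theta \<alpha>)"
      using measurable_compose[OF measurable_orbit[OF S x] f] .
    then have meas: "(\<lambda>r. f (S r x)) \<in> borel_measurable orthant_space"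
      using measurable_cong_sets[OF sets_theta refl] by blast
    have "orbit_integral S \<alpha> f (S s x) = (\<integral>\<^sup>+ r. f (S (vec_mult s r) x) \<partial>theta \<alpha>)"
      unfolding orbit_integral_def
    proof (rule nn_integral_cong)
      fix r assume "r \<in> space (theta \<alpha>)"
      then show "f (S r (S s x)) = f (S (vec_mult s r) x)"
        using S s x by (simp add: space_theta measurable_action_def vec_mult_commute[of s r])
    qed
    then show ?thesis
      by (simp add: nn_integral_theta_vec_mult[OF s meas] orbit_integral_def)
  qed
  then show ?thesis
    using borel_measurable_orbit_integral[OF S f] by (simp add: homogeneous_functions_def)
qed

lemma sets_orbit_measure [simp]: "sets (orbit_measure E S \<alpha> M Z) = sets E"
  by (simp add: orbit_measure_def sets.sigma_sets_eq sets.space_closed)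

lemma nn_integral_orbit_measure:
  assumes S: "measurable_action E S" and Z: "Z \<in> M \<rightarrow>\<^sub>M E" and f: "f \<in> borel_measurable E"
  shows "(\<integral>\<^sup>+ x. f x \<partial>orbit_measure E S \<alpha> M Z) = (\<integral>\<^sup>+ \<omega>. orbit_integral S \<alpha> f (Z \<omega>) \<partial>M)"
proof -
  interpret T: sigma_finite_measure "theta \<alpha>" by (rule sigma_finite_theta)
  note [measurable] = Z f
  have "(\<lambda>p. (snd p, Z (fst p))) \<in> M \<Otimes>\<^sub>M theta \<alpha> \<rightarrow>\<^sub>M theta \<alpha> \<Otimes>\<^sub>M E"
    by measurable
  from measurable_compose[OF this measurable_action_theta[OF S]]
  have act [measurable]: "(\<lambda>(\<omega>, r). S r (Z \<omega>)) \<in> M \<Otimes>\<^sub>M theta \<alpha> \<rightarrow>\<^sub>M E"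
    by (simp add: case_prod_beta)
  have tonelli: "(\<integral>\<^sup>+ x. g x \<partial>distr (M \<Otimes>\<^sub>M theta \<alpha>) E (\<lambda>(\<omega>, r). S r (Z \<omega>)))
      = (\<integral>\<^sup>+ \<omega>. (\<integral>\<^sup>+ r. g (S r (Z \<omega>)) \<partial>theta \<alpha>) \<partial>M)"
    if [measurable]: "g \<in> borel_measurable E" for g :: "_ \<Rightarrow> ennreal"
  proof -
    have "(\<integral>\<^sup>+ \<omega>. (\<integral>\<^sup>+ r. (\<lambda>(\<omega>, r). g (S r (Z \<omega>))) (\<omega>, r) \<partial>theta \<alpha>) \<partial>M)
        = (\<integral>\<^sup>+ p. (\<lambda>(\<omega>, r). g (S r (Z \<omega>))) p \<partial>(M \<Otimes>\<^sub>M theta \<alpha>))"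
      by (rule T.nn_integral_fst) measurable
    then show ?thesis
      by (simp add: nn_integral_distr[OF act] case_prod_beta)
  qed
  have "orbit_measure E S \<alpha> M Z = distr (M \<Otimes>\<^sub>M theta \<alpha>) E (\<lambda>(\<omega>, r). S r (Z \<omega>))"
  proof (rule measure_eqI)
    fix A assume "A \<in> sets (orbit_measure E S \<alpha> M Z)"
    then show "emeasure (orbit_measure E S \<alpha> M Z) A
        = emeasure (distr (M \<Otimes>\<^sub>M theta \<alpha>) E (\<lambda>(\<omega>, r). S r (Z \<omega>))) A"
      using tonelli[of "indicator A"] by (simp add: emeasure_orbit_measure[OF S Z])
  qed simp
  then show ?thesis
    by (simp add: tonelli[OF f] orbit_integral_def)
qed

text \<open>
  A positive function integrates to zero only against the zero measure; so \<open>\<Gamma>\<^sub>f x = 0\<close> would force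
  \<open>\<theta> = 0\<close>, and then every orbit measure would vanish as well.
\<close>

lemma orbit_integral_pos:
  assumes S: "measurable_action E S" and Z: "Z \<in> M \<rightarrow>\<^sub>M E"
    and nonzero: "emeasure (orbit_measure E S \<alpha> M Z) (space E) \<noteq> 0"
    and f: "f \<in> borel_measurable E" and pos: "\<And>x. x \<in> space E \<Longrightarrow> 0 < f x"
    and x: "x \<in> space E"
  shows "0 < orbit_integral S \<alpha> f x"
proof (rule ccontr)
  assume "\<not> 0 < orbit_integral S \<alpha> f x"
  then have "(\<integral>\<^sup>+ r. f (S r x) \<partial>theta \<alpha>) = 0"
    by (simp add: orbit_integral_def)
  then have "AE r in theta \<alpha>. f (S r x) = 0"
    using measurable_compose[OF measurable_orbit[OF S x] f]
    by (simp add: nn_integral_0_iff_AE)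
  then have null: "AE r in theta \<alpha>. False"
    using pos[OF orbit_closed[OF S x]]
    by (elim AE_mp) (force simp: space_theta intro!: AE_I2)
  have "(\<integral>\<^sup>+ r. indicator (space E) (S r (Z \<omega>)) \<partial>theta \<alpha>) = 0" for \<omega>
    using null by (subst nn_integral_cong_AE[where v = "\<lambda>_. 0"]) (auto elim: AE_mp)
  then have "emeasure (orbit_measure E S \<alpha> M Z) (space E) = 0"
    by (simp add: emeasure_orbit_measure[OF S Z])
  with nonzero show False by simp
qed

section \<open>Recovering homogeneous moments from the orbit measure\<close>

text \<open>
  Finiteness of \<open>\<integral> f d\<nu>\<^sub>Z = \<bbbE> \<Gamma>\<^sub>f(Z)\<close> makes \<open>\<Gamma>\<^sub>f(Z)\<close> finite almost surely. Along the orbit of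
  \<open>Z\<close> the factors \<open>\<chi> r\<close> of \<open>\<Gamma>\<close> and of \<open>\<Gamma>\<^sub>f\<close> cancel, so the orbit integral of \<open>f \<cdot> \<Gamma>/\<Gamma>\<^sub>f\<close> is
  \<open>\<Gamma>\<^sub>f(Z) \<cdot> \<Gamma>(Z)/\<Gamma>\<^sub>f(Z) = \<Gamma>(Z)\<close>.
\<close>

lemma homogeneous_moment_via_orbit_measure:
  assumes S: "measurable_action E S" and Z: "Z \<in> M \<rightarrow>\<^sub>M E"
    and f: "f \<in> borel_measurable E"
    and pos: "\<And>x. x \<in> space E \<Longrightarrow> 0 < orbit_integral S \<alpha> f x"
    and fin: "(\<integral>\<^sup>+ x. f x \<partial>orbit_measure E S \<alpha> M Z) \<noteq> \<infinity>"
    and \<Gamma>: "\<Gamma> \<in> homogeneous_functions E S \<alpha>"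
  shows "(\<integral>\<^sup>+ \<omega>. \<Gamma> (Z \<omega>) \<partial>M)
    = (\<integral>\<^sup>+ x. \<Gamma> x / orbit_integral S \<alpha> f x * f x \<partial>orbit_measure E S \<alpha> M Z)"
proof -
  let ?F = "orbit_integral S \<alpha> f"
  note F_hom = orbit_integral_homogeneous[OF S f, of \<alpha>]
  have [measurable]: "\<Gamma> \<in> borel_measurable E" "?F \<in> borel_measurable E"
    using \<Gamma> F_hom by (simp_all add: homogeneous_functions_def)
  note [measurable] = f Z
  have ratio: "\<Gamma> (S r x) / ?F (S r x) = \<Gamma> x / ?F x"
    if "r \<in> pos_orthant" "x \<in> space E" for r x
  proof -
    have "\<Gamma> (S r x) = ennreal (multipower \<alpha> r) * \<Gamma> x"
      and "?F (S r x) = ennreal (multipower \<alpha> r) * ?F x"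
      using \<Gamma> F_hom that by (simp_all add: homogeneous_functions_def)
    then show ?thesis
      using divide_mult_eq[of "ennreal (multipower \<alpha> r)" "\<Gamma> x" "?F x"]
        multipower_pos[OF that(1), of \<alpha>] by (simp add: mult.commute)
  qed
  have orbit: "orbit_integral S \<alpha> (\<lambda>x. \<Gamma> x / ?F x * f x) x = \<Gamma> x / ?F x * ?F x"
    if x: "x \<in> space E" for x
  proof -
    have "orbit_integral S \<alpha> (\<lambda>x. \<Gamma> x / ?F x * f x) x
        = (\<integral>\<^sup>+ r. \<Gamma> x / ?F x * f (S r x) \<partial>theta \<alpha>)"
      unfolding orbit_integral_def[of S \<alpha> "\<lambda>x. \<Gamma> x / ?F x * f x"]
      by (rule nn_integral_cong) (simp add: ratio x space_theta)
    also have "\<dots> = \<Gamma> x / ?F x * ?F x"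
      unfolding orbit_integral_def[of S \<alpha> f x]
      by (rule nn_integral_cmult) (rule measurable_compose[OF measurable_orbit[OF S x] f])
    finally show ?thesis .
  qed
  have "(\<integral>\<^sup>+ \<omega>. ?F (Z \<omega>) \<partial>M) \<noteq> \<infinity>"
    using fin by (simp add: nn_integral_orbit_measure[OF S Z f])
  then have "AE \<omega> in M. ?F (Z \<omega>) \<noteq> \<infinity>"
    by (intro nn_integral_PInf_AE) auto
  then have "AE \<omega> in M. \<Gamma> (Z \<omega>) = orbit_integral S \<alpha> (\<lambda>x. \<Gamma> x / ?F x * f x) (Z \<omega>)"
  proof (rule AE_mp, intro AE_I2 impI)
    fix \<omega> assume "\<omega> \<in> space M" and finite: "?F (Z \<omega>) \<noteq> \<infinity>"
    then have Z_in: "Z \<omega> \<in> space E" using measurable_space[OF Z] by blast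
    from pos[OF this] finite
    show "\<Gamma> (Z \<omega>) = orbit_integral S \<alpha> (\<lambda>x. \<Gamma> x / ?F x * f x) (Z \<omega>)"
      unfolding orbit[OF Z_in] by (simp add: ennreal_divide_times less_top)
  qed
  then have "(\<integral>\<^sup>+ \<omega>. \<Gamma> (Z \<omega>) \<partial>M)
      = (\<integral>\<^sup>+ \<omega>. orbit_integral S \<alpha> (\<lambda>x. \<Gamma> x / ?F x * f x) (Z \<omega>) \<partial>M)"
    by (rule nn_integral_cong_AE)
  then show ?thesis
    by (simp add: nn_integral_orbit_measure[OF S Z])
qed

theorem proposition2p5:
  fixes E :: "'a measure" and S :: "real ^ 'q \<Rightarrow> 'a \<Rightarrow> 'a" and \<alpha> :: "real ^ 'q"
    and M :: "'b measure" and N :: "'c measure" and Z :: "'b \<Rightarrow> 'a" and W :: "'c \<Rightarrow> 'a"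
  assumes "measurable_action E S"
    and "\<And>i. 0 < \<alpha> $ i"
    and "prob_space M" and "Z \<in> M \<rightarrow>\<^sub>M E"
    and "prob_space N" and "W \<in> N \<rightarrow>\<^sub>M E"
    and "orbit_measure E S \<alpha> M Z \<in> sigma_finite_homogeneous_measures E S \<alpha>"
  shows "orbit_measure E S \<alpha> N W = orbit_measure E S \<alpha> M Z \<longleftrightarrow>
    (\<forall>\<Gamma>\<in>homogeneous_functions E S \<alpha>. (\<integral>\<^sup>+ \<omega>. \<Gamma> (W \<omega>) \<partial>N) = (\<integral>\<^sup>+ \<omega>. \<Gamma> (Z \<omega>) \<partial>M))"
proof
  note S = assms(1) and Z = assms(4) and W = assms(6)
  let ?\<nu> = "orbit_measure E S \<alpha> M Z"
  have nonzero: "emeasure ?\<nu> (space E) \<noteq> 0" and "sigma_finite_measure ?\<nu>"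
    using assms(7) by (auto simp: sigma_finite_homogeneous_measures_def)
  then interpret \<nu>: sigma_finite_measure ?\<nu> by simp
  assume eq: "orbit_measure E S \<alpha> N W = ?\<nu>"
  obtain f where "f \<in> borel_measurable ?\<nu>" and fin: "(\<integral>\<^sup>+ x. f x \<partial>?\<nu>) \<noteq> \<infinity>"
    and "\<forall>x\<in>space ?\<nu>. 0 < f x \<and> f x < \<infinity>"
    using \<nu>.Ex_finite_integrable_function by blast
  then have f: "f \<in> borel_measurable E" and f_pos: "\<And>x. x \<in> space E \<Longrightarrow> 0 < f x"
    using measurable_cong_sets[OF sets_orbit_measure[of E S \<alpha> M Z] refl]
      sets_eq_imp_space_eq[OF sets_orbit_measure[of E S \<alpha> M Z]] by auto
  note pos = orbit_integral_pos[OF S Z nonzero f f_pos]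
  show "\<forall>\<Gamma>\<in>homogeneous_functions E S \<alpha>. (\<integral>\<^sup>+ \<omega>. \<Gamma> (W \<omega>) \<partial>N) = (\<integral>\<^sup>+ \<omega>. \<Gamma> (Z \<omega>) \<partial>M)"
  proof
    fix \<Gamma> assume \<Gamma>: "\<Gamma> \<in> homogeneous_functions E S \<alpha>"
    have "(\<integral>\<^sup>+ x. f x \<partial>orbit_measure E S \<alpha> N W) \<noteq> \<infinity>"
      using fin by (simp add: eq)
    from homogeneous_moment_via_orbit_measure[OF S W f pos this \<Gamma>]
      homogeneous_moment_via_orbit_measure[OF S Z f pos fin \<Gamma>]
    show "(\<integral>\<^sup>+ \<omega>. \<Gamma> (W \<omega>) \<partial>N) = (\<integral>\<^sup>+ \<omega>. \<Gamma> (Z \<omega>) \<partial>M)"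
      by (simp add: eq)
  qed
next
  note S = assms(1) and Z = assms(4) and W = assms(6)
  assume moments:
    "\<forall>\<Gamma>\<in>homogeneous_functions E S \<alpha>. (\<integral>\<^sup>+ \<omega>. \<Gamma> (W \<omega>) \<partial>N) = (\<integral>\<^sup>+ \<omega>. \<Gamma> (Z \<omega>) \<partial>M)"
  show "orbit_measure E S \<alpha> N W = orbit_measure E S \<alpha> M Z"
  proof (rule measure_eqI)
    fix A assume "A \<in> sets (orbit_measure E S \<alpha> N W)"
    then have A: "A \<in> sets E" by simp
    then have "orbit_integral S \<alpha> (indicator A) \<in> homogeneous_functions E S \<alpha>"
      by (intro orbit_integral_homogeneous[OF S]) simp
    with moments have "(\<integral>\<^sup>+ \<omega>. orbit_integral S \<alpha> (indicator A) (W \<omega>) \<partial>N)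
        = (\<integral>\<^sup>+ \<omega>. orbit_integral S \<alpha> (indicator A) (Z \<omega>) \<partial>M)"
      by (rule bspec)
    then show "emeasure (orbit_measure E S \<alpha> N W) A = emeasure (orbit_measure E S \<alpha> M Z) A"
      by (simp add: emeasure_orbit_measure[OF S W A] emeasure_orbit_measure[OF S Z A]
          orbit_integral_def)
  qed simp
qed

end
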